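(* Let $A$ be a commutative ring with nonzero identity, let $M$ be an $A$-module and $P$ a proper submodule of $M$. The following statements are equivalent. (i) $P$ is a classical 1-absorbing prime submodule of $M$. (ii) For all nonunits $a,b,c\in A$, $(P:_{M}abc)=(P:_{M}ab)$ or $(P:_{M}abc)=(P:_{M}c)$. (iii) For all nonunits $a,b,c\in A$ and every submodule $L$ of $M$, $abcL\subseteq P$ implies that $abL\subseteq P$ or $cL\subseteq P$. (iv) For all nonunits $a,b\in A$ and every submodule $L$ of $M$ with $abL\nsubseteq P$, $(P:_{A}abL)=(P:_{A}L)$. (v) For all nonunits $a,b\in A$, every proper ideal $I$ of $A$ and every submodule $L$ of $M$, $abIL\subseteq P$ implies that $abL\subseteq P$ or $IL\subseteq P$. (vi) For every nonunit $a\in A$, every proper ideal $I$ of $A$ and every submodule $L$ of $M$ with $aIL\nsubseteq P$, $(P:_{A}aIL)=(P:_{A}L)$. (vii) For every nonunit $a\in A$, all proper ideals $I,J$ of $A$ and every submodule $L$ of $M$, $aIJL\subseteq P$ implies either $aIL\subseteq P$ or $JL\subseteq P$. (viii) For all proper ideals $I,J$ of $A$ and every submodule $L$ of $M$ with $IJL\nsubseteq P$, $(P:_{A}IJL)=(P:_{A}L)$. (ix) For all proper ideals $I,J,K$ of $A$ and every submodule $L$ of $M$, $IJKL\subseteq P$ implies $IJL\subseteq P$ or $KL\subseteq P$. (x) For every submodule $L$ of $M$ which is not contained in $P$, $(P:_{A}L)$ is a 1-absorbing prime ideal of $A$.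
   Context: All rings are commutative with nonzero identity; the given module $M$ is nonzero and unital. A proper submodule $P$ of an $A$-module $M$ is a classical 1-absorbing prime submodule if whenever $abcm\in P$ for nonunits $a,b,c\in A$ and $m\in M$, then $abm\in P$ or $cm\in P$. A proper ideal $I$ of $A$ is a 1-absorbing prime ideal if whenever $abc\in I$ for nonunits $a,b,c\in A$, then $ab\in I$ or $c\in I$. For a submodule $P$ of $M$: $(P:_{M}x)=\{m\in M: xm\in P\}$ for $x\in A$, and $(P:_{A}K)=\{a\in A: aK\subseteq P\}$ for a subset $K\subseteq M$. *)

theory Defs
  imports "HOL-Algebra.Module" "HOL-Algebra.Ideal_Product"
begin

definition nonunits :: "('a, 'c) ring_scheme \<Rightarrow> 'a set" where
  "nonunits A = carrier A - Units A"

text \<open>The set \<open>x L\<close>, for a ring element \<open>x\<close> and a subset \<open>L\<close> of a module.\<close>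

definition elem_smult :: "('a, 'b, 'd) module_scheme \<Rightarrow> 'a \<Rightarrow> 'b set \<Rightarrow> 'b set" where
  "elem_smult M x L = (\<lambda>m. x \<odot>\<^bsub>M\<^esub> m) ` L"

text \<open>
  The product \<open>I L\<close> of an ideal and a submodule: all finite (nonempty) sums of elements \<open>i m\<close>
  with \<open>i \<in> I\<close> and \<open>m \<in> L\<close>, in the style of \<^const>\<open>ideal_prod\<close>. Zero and negatives need no
  clauses of their own, since \<open>I\<close> and \<open>L\<close> are meant to be an ideal and a submodule.
\<close>

inductive_set ideal_smult :: "('a, 'b, 'd) module_scheme \<Rightarrow> 'a set \<Rightarrow> 'b set \<Rightarrow> 'b set"
  for M and I and L where
    smult: "\<lbrakk> i \<in> I; m \<in> L \<rbrakk> \<Longrightarrow> i \<odot>\<^bsub>M\<^esub> m \<in> ideal_smult M I L"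
  | sum: "\<lbrakk> s \<in> ideal_smult M I L; t \<in> ideal_smult M I L \<rbrakk> \<Longrightarrow> s \<oplus>\<^bsub>M\<^esub> t \<in> ideal_smult M I L"

lemma (in Module.module) ideal_smult_is_submodule:
  assumes I: "ideal I R" and L: "submodule L R M"
  shows "submodule (ideal_smult M I L) R M"
proof -
  note LE = submoduleE[OF L]
  have I_sub: "i \<in> carrier R" if "i \<in> I" for i
    using that I by (simp add: ideal.Icarr)
  have L_sub: "m \<in> carrier M" if "m \<in> L" for m
    using that LE(1) by blast
  have carr: "s \<in> carrier M" if "s \<in> ideal_smult M I L" for s
    using that by induction (auto simp: I_sub L_sub)
  have scal: "a \<odot>\<^bsub>M\<^esub> s \<in> ideal_smult M I L"
    if a: "a \<in> carrier R" and s: "s \<in> ideal_smult M I L" for a s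
    using s
  proof induction
    case (smult i m)
    have "a \<odot>\<^bsub>M\<^esub> (i \<odot>\<^bsub>M\<^esub> m) = (a \<otimes> i) \<odot>\<^bsub>M\<^esub> m"
      using a smult by (simp add: smult_assoc1 I_sub L_sub)
    moreover have "a \<otimes> i \<in> I"
      using ideal.I_l_closed[OF I] smult(1) a by blast
    ultimately show ?case
      using smult(2) by (simp add: ideal_smult.smult)
  next
    case (sum s t)
    then show ?case
      using a by (simp add: smult_r_distr carr ideal_smult.sum)
  qed
  show ?thesis
  proof (rule submoduleI)
    show "ideal_smult M I L \<subseteq> carrier M"
      using carr by blast
    obtain m where m: "m \<in> L"
      using LE(2) by blast
    have "\<zero> \<in> I"
      using I by (simp add: additive_subgroup.zero_closed ideal.axioms(1))
    from ideal_smult.smult[OF this m, of M] show "\<zero>\<^bsub>M\<^esub> \<in> ideal_smult M I L"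
      using m by (simp add: L_sub)
    show "\<ominus>\<^bsub>M\<^esub> s \<in> ideal_smult M I L" if s: "s \<in> ideal_smult M I L" for s
      using scal[of "\<ominus> \<one>", OF _ s] by (simp add: smult_l_minus carr[OF s])
  qed (auto intro: scal ideal_smult.sum)
qed

text \<open>The residuals \<open>(P :\<^sub>M x)\<close> and \<open>(P :\<^sub>A K)\<close>.\<close>

definition residual_in_module ::
    "('a, 'b, 'd) module_scheme \<Rightarrow> 'b set \<Rightarrow> 'a \<Rightarrow> 'b set" where
  "residual_in_module M P x = {m \<in> carrier M. x \<odot>\<^bsub>M\<^esub> m \<in> P}"

definition residual_in_ring ::
    "('a, 'c) ring_scheme \<Rightarrow> ('a, 'b, 'd) module_scheme \<Rightarrow> 'b set \<Rightarrow> 'b set \<Rightarrow> 'a set" where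
  "residual_in_ring A M P K = {a \<in> carrier A. elem_smult M a K \<subseteq> P}"

definition classical_1_absorbing_prime_submodule ::
    "'b set \<Rightarrow> ('a, 'c) ring_scheme \<Rightarrow> ('a, 'b, 'd) module_scheme \<Rightarrow> bool" where
  "classical_1_absorbing_prime_submodule P A M \<longleftrightarrow>
     submodule P A M \<and> P \<noteq> carrier M \<and>
     (\<forall>a\<in>nonunits A. \<forall>b\<in>nonunits A. \<forall>c\<in>nonunits A. \<forall>m\<in>carrier M.
        (a \<otimes>\<^bsub>A\<^esub> b \<otimes>\<^bsub>A\<^esub> c) \<odot>\<^bsub>M\<^esub> m \<in> P \<longrightarrow>
        (a \<otimes>\<^bsub>A\<^esub> b) \<odot>\<^bsub>M\<^esub> m \<in> P \<or> c \<odot>\<^bsub>M\<^esub> m \<in> P)"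

definition proper_ideal :: "'a set \<Rightarrow> ('a, 'c) ring_scheme \<Rightarrow> bool" where
  "proper_ideal I A \<longleftrightarrow> ideal I A \<and> I \<noteq> carrier A"

definition one_absorbing_prime_ideal :: "'a set \<Rightarrow> ('a, 'c) ring_scheme \<Rightarrow> bool" where
  "one_absorbing_prime_ideal I A \<longleftrightarrow>
     proper_ideal I A \<and>
     (\<forall>a\<in>nonunits A. \<forall>b\<in>nonunits A. \<forall>c\<in>nonunits A.
        a \<otimes>\<^bsub>A\<^esub> b \<otimes>\<^bsub>A\<^esub> c \<in> I \<longrightarrow> a \<otimes>\<^bsub>A\<^esub> b \<in> I \<or> c \<in> I)"

end

theory Submission
  imports Defs
begin

text \<open>
  Each of (iii) to (x) speaks about one submodule \<open>L\<close> at a time, and what it says about \<open>L\<close>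
  depends only on the ideal \<open>Q = (P :\<^sub>A L)\<close>: the inclusion \<open>xL \<subseteq> P\<close> means \<open>x \<in> Q\<close>, the
  inclusion \<open>IL \<subseteq> P\<close> means \<open>I \<subseteq> Q\<close>, and \<open>(P :\<^sub>A XL)\<close> is the colon ideal \<open>(Q : X)\<close>
  (\<open>ideal_smult_subset_iff\<close>, \<open>residual_in_ring_ideal_prod_smult\<close> and their companions). So (iii) to
  (x) turn into statements about an ideal \<open>Q\<close> of a commutative ring, and for each single \<open>Q\<close> they
  all say the same thing: \<open>abc \<in> Q\<close> with nonunits \<open>a\<close>, \<open>b\<close>, \<open>c\<close> forces \<open>ab \<in> Q\<close> or \<open>c \<in> Q\<close>.

  In the ring, the main point is \<open>absorbs_triples_colon_eq\<close>: if \<open>X\<close> consists of products of two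
  nonunits and is not contained in an absorbing \<open>Q\<close>, then \<open>(Q : X) = Q\<close>. This covers
  \<open>X = {ab}\<close>, \<open>aI\<close> and \<open>IJ\<close>, since a proper ideal contains only nonunits. The converse
  directions specialise to principal ideals, which are proper when generated by a nonunit.

  It remains to link the elementwise definition (i) with submodules. From submodules to elements,
  take \<open>L = Am\<close>. From elements to submodules, (i) says that \<open>(P :\<^sub>M abc)\<close> is contained in the union
  of the submodules \<open>(P :\<^sub>M ab)\<close> and \<open>(P :\<^sub>M c)\<close>; a submodule covered by two submodules lies in one
  of them (\<open>submodule_subset_Un\<close>). This gives (ii), and (ii) passes to every \<open>L\<close> because
  \<open>xL \<subseteq> P\<close> means \<open>L \<subseteq> (P :\<^sub>M x)\<close>.
\<close>

section \<open>Ideals that absorb triple products of nonunits\<close>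

text \<open>The defining condition of a 1-absorbing prime ideal, without properness: the residual of a
  submodule contained in \<open>P\<close> is the whole ring, and it should satisfy the condition trivially.\<close>

definition absorbs_triples :: "('a, 'c) ring_scheme \<Rightarrow> 'a set \<Rightarrow> bool" where
  "absorbs_triples A Q \<longleftrightarrow>
     (\<forall>a\<in>nonunits A. \<forall>b\<in>nonunits A. \<forall>c\<in>nonunits A.
        a \<otimes>\<^bsub>A\<^esub> b \<otimes>\<^bsub>A\<^esub> c \<in> Q \<longrightarrow> a \<otimes>\<^bsub>A\<^esub> b \<in> Q \<or> c \<in> Q)"

text \<open>The ideal quotient \<open>(Q : X)\<close>, for an arbitrary subset \<open>X\<close>. For an ideal \<open>Q\<close> it depends only on
  the ideal generated by \<open>X\<close>, so \<open>(Q : IJ)\<close> can be formed with the set of products \<open>ij\<close> in place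
  of the ideal product \<open>IJ\<close>.\<close>

definition colon :: "('a, 'c) ring_scheme \<Rightarrow> 'a set \<Rightarrow> 'a set \<Rightarrow> 'a set" where
  "colon A Q X = {x \<in> carrier A. \<forall>y\<in>X. y \<otimes>\<^bsub>A\<^esub> x \<in> Q}"

definition nonunit_products :: "('a, 'c) ring_scheme \<Rightarrow> 'a set" where
  "nonunit_products A = {a \<otimes>\<^bsub>A\<^esub> b | a b. a \<in> nonunits A \<and> b \<in> nonunits A}"

lemma nonunits_closed: "a \<in> nonunits A \<Longrightarrow> a \<in> carrier A"
  by (simp add: nonunits_def)

lemma proper_ideal_is_ideal: "proper_ideal I A \<Longrightarrow> ideal I A"
  by (simp add: proper_ideal_def)

lemma proper_ideal_closed: "proper_ideal I A \<Longrightarrow> i \<in> I \<Longrightarrow> i \<in> carrier A"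
  by (rule ideal.Icarr[OF proper_ideal_is_ideal])

context cring
begin

lemma ideal_unit_cancel:
  assumes "ideal Q R" "y \<in> carrier R" "x \<in> Units R" "y \<otimes> x \<in> Q"
  shows "y \<in> Q"
proof -
  have "y \<otimes> x \<otimes> inv x \<in> Q"
    using assms by (simp add: ideal.I_r_closed)
  then show ?thesis
    using assms by (simp add: m_assoc Units_closed)
qed

lemma proper_ideal_subset_nonunits:
  assumes "proper_ideal I R" "i \<in> I"
  shows "i \<in> nonunits R"
proof -
  have "i \<notin> Units R"
  proof
    assume u: "i \<in> Units R"
    have I: "ideal I R" "i \<in> carrier R"
      using assms by (auto intro: proper_ideal_is_ideal proper_ideal_closed)
    then have "\<one> \<in> I"
      using ideal_unit_cancel[of I \<one> i] u assms(2) by simp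
    then show False
      using ideal.one_imp_carrier[OF I(1)] assms(1) by (simp add: proper_ideal_def)
  qed
  then show ?thesis
    using assms by (simp add: nonunits_def proper_ideal_closed)
qed

lemma proper_ideal_cgenideal:
  assumes "a \<in> nonunits R"
  shows "proper_ideal (PIdl a) R"
proof -
  have a: "a \<in> carrier R" "a \<notin> Units R"
    using assms by (auto simp: nonunits_def)
  have "\<one> \<notin> PIdl a"
  proof
    assume "\<one> \<in> PIdl a"
    then obtain x where "x \<in> carrier R" "\<one> = x \<otimes> a"
      by (auto simp: cgenideal_def)
    then have "a \<in> Units R"
      using a(1) m_comm[of x a] by (auto simp: Units_def)
    then show False
      using a(2) by contradiction
  qed
  then show ?thesis
    using a cgenideal_ideal[OF a(1)] by (auto simp: proper_ideal_def)
qed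

text \<open>The ideal generated by \<open>a\<close> may replace \<open>a\<close> in any product that is tested for membership
  in an ideal \<open>Q\<close>; this is what turns a statement about ideals back into one about elements.\<close>

lemma cgenideal_mult_in_ideal_iff:
  assumes Q: "ideal Q R" and "a \<in> carrier R" "y \<in> carrier R"
  shows "(\<forall>i\<in>PIdl a. y \<otimes> i \<in> Q) \<longleftrightarrow> y \<otimes> a \<in> Q"
proof
  assume "\<forall>i\<in>PIdl a. y \<otimes> i \<in> Q"
  then show "y \<otimes> a \<in> Q"
    using cgenideal_self[OF assms(2)] by blast
next
  assume ya: "y \<otimes> a \<in> Q"
  have "y \<otimes> (x \<otimes> a) \<in> Q" if "x \<in> carrier R" for x
    using ideal.I_l_closed[OF Q ya that] assms that by (simp add: m_lcomm)
  then show "\<forall>i\<in>PIdl a. y \<otimes> i \<in> Q"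
    by (auto simp: cgenideal_def)
qed

lemma cgenideal_subset_ideal_iff:
  assumes "ideal Q R" "a \<in> carrier R"
  shows "PIdl a \<subseteq> Q \<longleftrightarrow> a \<in> Q"
  using assms cgenideal_self cgenideal_minimal by blast

text \<open>Since \<open>Q\<close> is closed under sums, the generators of \<open>IJ\<close> suffice. The factor \<open>y\<close> carries a
  further ring element, as in \<open>aIJ\<close>, or an element of a third ideal, as in \<open>IJK\<close>.\<close>

lemma mult_ideal_prod_in_ideal_iff:
  assumes Q: "ideal Q R" and I: "ideal I R" and J: "ideal J R" and y: "y \<in> carrier R"
  shows "(\<forall>k\<in>I \<cdot> J. y \<otimes> k \<in> Q) \<longleftrightarrow> (\<forall>i\<in>I. \<forall>j\<in>J. y \<otimes> (i \<otimes> j) \<in> Q)"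
proof
  assume *: "\<forall>i\<in>I. \<forall>j\<in>J. y \<otimes> (i \<otimes> j) \<in> Q"
  have "y \<otimes> k \<in> Q" if "k \<in> I \<cdot> J" for k
    using that
  proof induction
    case (prod i j)
    then show ?case using * by blast
  next
    case (sum s t)
    then have "s \<in> carrier R" "t \<in> carrier R"
      using ideal_prod_in_carrier[OF I J] by auto
    then show ?case
      using sum Q y by (simp add: r_distr additive_subgroup.a_closed ideal.axioms(1))
  qed
  then show "\<forall>k\<in>I \<cdot> J. y \<otimes> k \<in> Q"
    by blast
qed (auto intro: ideal_prod.prod)

lemma ideal_prod_subset_ideal_iff:
  assumes Q: "ideal Q R" and I: "ideal I R" and J: "ideal J R"
  shows "I \<cdot> J \<subseteq> Q \<longleftrightarrow> (\<forall>i\<in>I. \<forall>j\<in>J. i \<otimes> j \<in> Q)"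
  using mult_ideal_prod_in_ideal_iff[OF assms one_closed] ideal_prod_in_carrier[OF I J]
    ideal.Icarr[OF I] ideal.Icarr[OF J]
  by (simp add: subset_iff Ball_def)

lemma subset_colon:
  assumes "ideal Q R" "X \<subseteq> carrier R"
  shows "Q \<subseteq> colon R Q X"
  using assms by (auto simp: colon_def ideal.Icarr intro!: ideal.I_l_closed)

text \<open>If \<open>y = ab\<close> is a product of two nonunits outside \<open>Q\<close> and \<open>yx \<in> Q\<close>, then \<open>x\<close> is not a
  unit, for otherwise \<open>y\<close> would lie in \<open>Q\<close>. Absorption therefore applies to \<open>abx\<close> and leaves
  only \<open>x \<in> Q\<close>. One such \<open>y\<close> in \<open>X\<close> is enough.\<close>

lemma absorbs_triples_colon_eq:
  assumes Q: "ideal Q R" and abs: "absorbs_triples R Q"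
    and X: "X \<subseteq> nonunit_products R" and XQ: "\<not> X \<subseteq> Q"
  shows "colon R Q X = Q"
proof
  obtain a b where ab: "a \<in> nonunits R" "b \<in> nonunits R" "a \<otimes> b \<in> X" "a \<otimes> b \<notin> Q"
    using X XQ unfolding nonunit_products_def by blast
  then have cl: "a \<otimes> b \<in> carrier R"
    by (simp add: nonunits_closed)
  show "colon R Q X \<subseteq> Q"
  proof
    fix x assume "x \<in> colon R Q X"
    then have x: "x \<in> carrier R" "a \<otimes> b \<otimes> x \<in> Q"
      using ab(3) by (auto simp: colon_def)
    then have "x \<in> nonunits R"
      using ideal_unit_cancel[OF Q cl] ab(4) by (auto simp: nonunits_def)
    then show "x \<in> Q"
      using abs ab x(2) unfolding absorbs_triples_def by blast
  qed
  have "X \<subseteq> carrier R"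
    using X by (auto simp: nonunit_products_def nonunits_closed)
  then show "Q \<subseteq> colon R Q X"
    by (rule subset_colon[OF Q])
qed

lemma absorbs_triples_iff_colon_elem:
  assumes Q: "ideal Q R"
  shows "absorbs_triples R Q \<longleftrightarrow>
    (\<forall>a\<in>nonunits R. \<forall>b\<in>nonunits R. a \<otimes> b \<notin> Q \<longrightarrow> colon R Q {a \<otimes> b} = Q)"
proof
  assume "absorbs_triples R Q"
  then show "\<forall>a\<in>nonunits R. \<forall>b\<in>nonunits R. a \<otimes> b \<notin> Q \<longrightarrow> colon R Q {a \<otimes> b} = Q"
    by (intro ballI impI absorbs_triples_colon_eq[OF Q]) (auto simp: nonunit_products_def)
next
  assume *: "\<forall>a\<in>nonunits R. \<forall>b\<in>nonunits R. a \<otimes> b \<notin> Q \<longrightarrow> colon R Q {a \<otimes> b} = Q"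
  show "absorbs_triples R Q"
    unfolding absorbs_triples_def
  proof (intro ballI impI)
    fix a b c
    assume abc: "a \<in> nonunits R" "b \<in> nonunits R" "c \<in> nonunits R" "a \<otimes> b \<otimes> c \<in> Q"
    then have "c \<in> colon R Q {a \<otimes> b}"
      by (simp add: colon_def nonunits_closed)
    then show "a \<otimes> b \<in> Q \<or> c \<in> Q"
      using * abc by blast
  qed
qed

text \<open>The remaining conditions on \<open>Q\<close> replace some of the nonunits by proper ideals. All elements
  of a proper ideal are nonunits, so the products that occur still lie in \<^const>\<open>nonunit_products\<close>;
  conversely a nonunit generates a proper ideal.\<close>

lemma absorbs_triples_iff_mult_ideal:
  assumes Q: "ideal Q R"
  shows "absorbs_triples R Q \<longleftrightarrow>
    (\<forall>a\<in>nonunits R. \<forall>b\<in>nonunits R. \<forall>I. proper_ideal I R \<longrightarrow>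
       (\<forall>i\<in>I. a \<otimes> b \<otimes> i \<in> Q) \<longrightarrow> a \<otimes> b \<in> Q \<or> I \<subseteq> Q)" (is "_ \<longleftrightarrow> ?R")
proof
  assume "absorbs_triples R Q"
  then show ?R
    unfolding absorbs_triples_def by (meson proper_ideal_subset_nonunits subsetI)
next
  assume R: ?R
  show "absorbs_triples R Q"
    unfolding absorbs_triples_def
  proof (intro ballI impI)
    fix a b c
    assume abc: "a \<in> nonunits R" "b \<in> nonunits R" "c \<in> nonunits R" "a \<otimes> b \<otimes> c \<in> Q"
    note cl = abc(1-3)[THEN nonunits_closed]
    have "a \<otimes> b \<in> Q \<or> PIdl c \<subseteq> Q"
      using R abc cl proper_ideal_cgenideal[OF abc(3)]
      by (simp add: cgenideal_mult_in_ideal_iff[OF Q])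
    then show "a \<otimes> b \<in> Q \<or> c \<in> Q"
      using cl by (simp add: cgenideal_subset_ideal_iff[OF Q])
  qed
qed

lemma absorbs_triples_iff_colon_mult_ideal:
  assumes Q: "ideal Q R"
  shows "absorbs_triples R Q \<longleftrightarrow>
    (\<forall>a\<in>nonunits R. \<forall>I. proper_ideal I R \<and> \<not> (\<forall>i\<in>I. a \<otimes> i \<in> Q) \<longrightarrow>
       colon R Q {a \<otimes> i | i. i \<in> I} = Q)" (is "_ \<longleftrightarrow> ?R")
proof
  assume "absorbs_triples R Q"
  moreover have "{a \<otimes> i | i. i \<in> I} \<subseteq> nonunit_products R"
    if "a \<in> nonunits R" "proper_ideal I R" for a I
    using that proper_ideal_subset_nonunits unfolding nonunit_products_def by blast
  ultimately show ?R
    by (intro ballI allI impI absorbs_triples_colon_eq[OF Q]) blast+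
next
  assume R: ?R
  show "absorbs_triples R Q"
    unfolding absorbs_triples_def
  proof (intro ballI impI)
    fix a b c
    assume abc: "a \<in> nonunits R" "b \<in> nonunits R" "c \<in> nonunits R" "a \<otimes> b \<otimes> c \<in> Q"
    note cl = abc(1-3)[THEN nonunits_closed]
    have "c \<otimes> a \<otimes> b \<in> Q"
      using abc(4) cl by (simp add: m_ac)
    then have "\<forall>i\<in>PIdl b. c \<otimes> a \<otimes> i \<in> Q"
      using cl by (simp add: cgenideal_mult_in_ideal_iff[OF Q])
    moreover have "i \<in> carrier R" if "i \<in> PIdl b" for i
      using that cl by (auto simp: cgenideal_def)
    ultimately have "c \<in> colon R Q {a \<otimes> i | i. i \<in> PIdl b}"
      using cl by (auto simp: colon_def m_ac)
    moreover have "(\<forall>i\<in>PIdl b. a \<otimes> i \<in> Q) \<or> colon R Q {a \<otimes> i | i. i \<in> PIdl b} = Q"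
      using R abc(1) proper_ideal_cgenideal[OF abc(2)] by blast
    ultimately show "a \<otimes> b \<in> Q \<or> c \<in> Q"
      using cgenideal_mult_in_ideal_iff[OF Q cl(2,1)] by blast
  qed
qed

lemma absorbs_triples_iff_mult_two_ideals:
  assumes Q: "ideal Q R"
  shows "absorbs_triples R Q \<longleftrightarrow>
    (\<forall>a\<in>nonunits R. \<forall>I J. proper_ideal I R \<and> proper_ideal J R \<longrightarrow>
       (\<forall>i\<in>I. \<forall>j\<in>J. a \<otimes> (i \<otimes> j) \<in> Q) \<longrightarrow> (\<forall>i\<in>I. a \<otimes> i \<in> Q) \<or> J \<subseteq> Q)" (is "_ \<longleftrightarrow> ?R")
proof
  assume abs: "absorbs_triples R Q"
  show ?R
  proof (intro ballI allI impI)
    fix a I J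
    assume a: "a \<in> nonunits R" and IJ: "proper_ideal I R \<and> proper_ideal J R"
      and *: "\<forall>i\<in>I. \<forall>j\<in>J. a \<otimes> (i \<otimes> j) \<in> Q"
    have "J \<subseteq> colon R Q {a \<otimes> i | i. i \<in> I}"
      using * a IJ by (auto simp: colon_def m_assoc nonunits_closed proper_ideal_closed)
    then show "(\<forall>i\<in>I. a \<otimes> i \<in> Q) \<or> J \<subseteq> Q"
      using abs a IJ unfolding absorbs_triples_iff_colon_mult_ideal[OF Q] by blast
  qed
next
  assume R: ?R
  show "absorbs_triples R Q"
    unfolding absorbs_triples_def
  proof (intro ballI impI)
    fix a b c
    assume abc: "a \<in> nonunits R" "b \<in> nonunits R" "c \<in> nonunits R" "a \<otimes> b \<otimes> c \<in> Q"
    note cl = abc(1-3)[THEN nonunits_closed]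
    note pr = abc(1-3)[THEN proper_ideal_cgenideal]
    have "a \<otimes> (i \<otimes> j) \<in> Q" if ij: "i \<in> PIdl b" "j \<in> PIdl c" for i j
    proof -
      have "j \<in> carrier R" "i \<in> carrier R"
        using ij pr by (auto intro: proper_ideal_closed)
      moreover have "a \<otimes> b \<otimes> j \<in> Q"
        using cgenideal_mult_in_ideal_iff[OF Q, of c "a \<otimes> b"] abc(4) cl ij by simp
      then have "a \<otimes> j \<otimes> b \<in> Q"
        using cl \<open>j \<in> carrier R\<close> by (simp add: m_ac)
      then have "a \<otimes> j \<otimes> i \<in> Q"
        using cgenideal_mult_in_ideal_iff[OF Q, of b "a \<otimes> j"] cl ij \<open>j \<in> carrier R\<close> by simp
      ultimately show ?thesis
        using cl by (simp add: m_ac)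
    qed
    then have "(\<forall>i\<in>PIdl b. a \<otimes> i \<in> Q) \<or> PIdl c \<subseteq> Q"
      using R abc(1) pr by blast
    then show "a \<otimes> b \<in> Q \<or> c \<in> Q"
      using cl by (simp add: cgenideal_subset_ideal_iff[OF Q] cgenideal_mult_in_ideal_iff[OF Q])
  qed
qed

text \<open>In the two lemmas below it is enough to recover the condition for a nonunit \<open>a\<close> and two ideals
  \<open>I\<close>, \<open>J\<close>: the ideal generated by \<open>a\<close> takes the place of the missing ideal.\<close>

lemma absorbs_triples_iff_colon_two_ideals:
  assumes Q: "ideal Q R"
  shows "absorbs_triples R Q \<longleftrightarrow>
    (\<forall>I J. proper_ideal I R \<and> proper_ideal J R \<and> \<not> (\<forall>i\<in>I. \<forall>j\<in>J. i \<otimes> j \<in> Q) \<longrightarrow>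
       colon R Q {i \<otimes> j | i j. i \<in> I \<and> j \<in> J} = Q)" (is "_ \<longleftrightarrow> ?R")
proof
  assume "absorbs_triples R Q"
  moreover have "{i \<otimes> j | i j. i \<in> I \<and> j \<in> J} \<subseteq> nonunit_products R"
    if "proper_ideal I R" "proper_ideal J R" for I J
    using that proper_ideal_subset_nonunits unfolding nonunit_products_def by blast
  ultimately show ?R
    by (intro allI impI absorbs_triples_colon_eq[OF Q]) blast+
next
  assume R: ?R
  show "absorbs_triples R Q"
    unfolding absorbs_triples_iff_mult_two_ideals[OF Q]
  proof (intro ballI allI impI)
    fix a I J
    assume a: "a \<in> nonunits R" and IJ: "proper_ideal I R \<and> proper_ideal J R"
      and *: "\<forall>i\<in>I. \<forall>j\<in>J. a \<otimes> (i \<otimes> j) \<in> Q"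
    note cl = nonunits_closed[OF a]
    have "j \<in> colon R Q {k \<otimes> i | k i. k \<in> PIdl a \<and> i \<in> I}" if j: "j \<in> J" for j
    proof -
      have "k \<otimes> i \<otimes> j \<in> Q" if "k \<in> PIdl a" "i \<in> I" for k i
      proof -
        have c: "i \<in> carrier R" "j \<in> carrier R" "k \<in> carrier R"
          using that j IJ proper_ideal_cgenideal[OF a] by (auto intro: proper_ideal_closed)
        have "i \<otimes> j \<otimes> a \<in> Q"
          using * that(2) j c cl by (simp add: m_comm[of "i \<otimes> j" a])
        then have "i \<otimes> j \<otimes> k \<in> Q"
          using cgenideal_mult_in_ideal_iff[OF Q, of a "i \<otimes> j"] c cl that(1) by simp
        then show ?thesis
          using c by (simp add: m_ac)
      qed
      moreover have "j \<in> carrier R"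
        using j IJ by (auto intro: proper_ideal_closed)
      ultimately show ?thesis
        unfolding colon_def by blast
    qed
    then have "J \<subseteq> colon R Q {k \<otimes> i | k i. k \<in> PIdl a \<and> i \<in> I}"
      by (rule subsetI)
    moreover have "(\<forall>k\<in>PIdl a. \<forall>i\<in>I. k \<otimes> i \<in> Q) \<or>
        colon R Q {k \<otimes> i | k i. k \<in> PIdl a \<and> i \<in> I} = Q"
      using R[rule_format, of "PIdl a" I] IJ proper_ideal_cgenideal[OF a] by blast
    ultimately have "J \<subseteq> Q \<or> (\<forall>k\<in>PIdl a. \<forall>i\<in>I. k \<otimes> i \<in> Q)"
      by auto
    then show "(\<forall>i\<in>I. a \<otimes> i \<in> Q) \<or> J \<subseteq> Q"
      using cgenideal_self[OF cl] by blast
  qed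
qed

lemma absorbs_triples_iff_mult_three_ideals:
  assumes Q: "ideal Q R"
  shows "absorbs_triples R Q \<longleftrightarrow>
    (\<forall>I J K. proper_ideal I R \<and> proper_ideal J R \<and> proper_ideal K R \<longrightarrow>
       (\<forall>i\<in>I. \<forall>j\<in>J. \<forall>k\<in>K. i \<otimes> j \<otimes> k \<in> Q) \<longrightarrow> (\<forall>i\<in>I. \<forall>j\<in>J. i \<otimes> j \<in> Q) \<or> K \<subseteq> Q)"
    (is "_ \<longleftrightarrow> ?R")
proof
  assume abs: "absorbs_triples R Q"
  show ?R
  proof (intro allI impI)
    fix I J K
    assume IJK: "proper_ideal I R \<and> proper_ideal J R \<and> proper_ideal K R"
      and *: "\<forall>i\<in>I. \<forall>j\<in>J. \<forall>k\<in>K. i \<otimes> j \<otimes> k \<in> Q"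
    have "K \<subseteq> colon R Q {i \<otimes> j | i j. i \<in> I \<and> j \<in> J}"
      using * IJK by (auto simp: colon_def proper_ideal_closed)
    then show "(\<forall>i\<in>I. \<forall>j\<in>J. i \<otimes> j \<in> Q) \<or> K \<subseteq> Q"
      using abs IJK unfolding absorbs_triples_iff_colon_two_ideals[OF Q] by blast
  qed
next
  assume R: ?R
  show "absorbs_triples R Q"
    unfolding absorbs_triples_iff_mult_two_ideals[OF Q]
  proof (intro ballI allI impI)
    fix a I J
    assume a: "a \<in> nonunits R" and IJ: "proper_ideal I R \<and> proper_ideal J R"
      and *: "\<forall>i\<in>I. \<forall>j\<in>J. a \<otimes> (i \<otimes> j) \<in> Q"
    note cl = nonunits_closed[OF a]
    have "k \<otimes> i \<otimes> j \<in> Q" if "k \<in> PIdl a" "i \<in> I" "j \<in> J" for k i j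
    proof -
      have c: "i \<in> carrier R" "j \<in> carrier R" "k \<in> carrier R"
        using that IJ proper_ideal_cgenideal[OF a] by (auto intro: proper_ideal_closed)
      have "i \<otimes> j \<otimes> a \<in> Q"
        using * that c cl by (simp add: m_comm[of "i \<otimes> j" a])
      then have "i \<otimes> j \<otimes> k \<in> Q"
        using cgenideal_mult_in_ideal_iff[OF Q, of a "i \<otimes> j"] c cl that(1) by simp
      then show ?thesis
        using c by (simp add: m_ac)
    qed
    then have "J \<subseteq> Q \<or> (\<forall>k\<in>PIdl a. \<forall>i\<in>I. k \<otimes> i \<in> Q)"
      using R IJ proper_ideal_cgenideal[OF a] by blast
    then show "(\<forall>i\<in>I. a \<otimes> i \<in> Q) \<or> J \<subseteq> Q"
      using cgenideal_self[OF cl] by blast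
  qed
qed

end

section \<open>Residuals of a submodule\<close>

lemma residual_in_ring_iff:
  "a \<in> carrier A \<Longrightarrow> a \<in> residual_in_ring A M P L \<longleftrightarrow> (\<forall>m\<in>L. a \<odot>\<^bsub>M\<^esub> m \<in> P)"
  by (auto simp: residual_in_ring_def elem_smult_def)

lemma elem_smult_subset_iff:
  "a \<in> carrier A \<Longrightarrow> elem_smult M a L \<subseteq> P \<longleftrightarrow> a \<in> residual_in_ring A M P L"
  by (simp add: residual_in_ring_def)

context Module.module
begin

lemma submodule_zero_closed:
  assumes "submodule P R M"
  shows "\<zero>\<^bsub>M\<^esub> \<in> P"
proof -
  obtain p where "p \<in> P"
    using submoduleE(2)[OF assms] by blast
  then have "p \<in> carrier M" "\<zero> \<odot>\<^bsub>M\<^esub> p \<in> P"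
    using submoduleE(1,4)[OF assms] by auto
  then show ?thesis
    by simp
qed

lemma submodule_residual_in_module:
  assumes P: "submodule P R M" and x: "x \<in> carrier R"
  shows "submodule (residual_in_module M P x) R M"
proof (rule submoduleI)
  note PE = submoduleE[OF P]
  note P0 = submodule_zero_closed[OF P]
  show "\<zero>\<^bsub>M\<^esub> \<in> residual_in_module M P x"
    using x P0 by (simp add: residual_in_module_def)
  show "\<ominus>\<^bsub>M\<^esub> m \<in> residual_in_module M P x" if "m \<in> residual_in_module M P x" for m
    using that x PE(3) by (simp add: residual_in_module_def smult_r_minus)
  show "m \<oplus>\<^bsub>M\<^esub> n \<in> residual_in_module M P x"
    if "m \<in> residual_in_module M P x" "n \<in> residual_in_module M P x" for m n
    using that x PE(5) by (simp add: residual_in_module_def smult_r_distr)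
  show "a \<odot>\<^bsub>M\<^esub> m \<in> residual_in_module M P x"
    if a: "a \<in> carrier R" and m: "m \<in> residual_in_module M P x" for a m
  proof -
    have "a \<odot>\<^bsub>M\<^esub> (x \<odot>\<^bsub>M\<^esub> m) \<in> P" "m \<in> carrier M"
      using a m PE(4) by (auto simp: residual_in_module_def)
    then show ?thesis
      using a x by (simp add: residual_in_module_def flip: smult_assoc1) (simp add: m_comm)
  qed
qed (auto simp: residual_in_module_def)

lemma ideal_residual_in_ring:
  assumes P: "submodule P R M" and L: "submodule L R M"
  shows "ideal (residual_in_ring R M P L) R"
proof (rule idealI)
  note PE = submoduleE[OF P]
  have Lc: "m \<in> carrier M" if "m \<in> L" for m
    using submoduleE(1)[OF L] that by blast
  note P0 = submodule_zero_closed[OF P]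
  have l: "x \<otimes> a \<in> residual_in_ring R M P L"
    if "a \<in> residual_in_ring R M P L" "x \<in> carrier R" for a x
    using that PE(4) Lc by (auto simp: residual_in_ring_def elem_smult_def smult_assoc1)
  show "x \<otimes> a \<in> residual_in_ring R M P L"
    if "a \<in> residual_in_ring R M P L" "x \<in> carrier R" for a x
    using l that .
  show "a \<otimes> x \<in> residual_in_ring R M P L"
    if "a \<in> residual_in_ring R M P L" "x \<in> carrier R" for a x
    using l[OF that] that by (simp add: m_comm residual_in_ring_def)
  show "subgroup (residual_in_ring R M P L) (add_monoid R)"
  proof (rule R.add.subgroupI)
    show "residual_in_ring R M P L \<noteq> {}"
    proof -
      have "\<zero> \<in> residual_in_ring R M P L"
        using P0 Lc by (auto simp: residual_in_ring_def elem_smult_def)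
      then show ?thesis by blast
    qed
    show "\<ominus> a \<in> residual_in_ring R M P L" if "a \<in> residual_in_ring R M P L" for a
      using that PE(3) Lc by (auto simp: residual_in_ring_def elem_smult_def smult_l_minus)
    show "a \<oplus> b \<in> residual_in_ring R M P L"
      if "a \<in> residual_in_ring R M P L" "b \<in> residual_in_ring R M P L" for a b
      using that PE(5) Lc by (auto simp: residual_in_ring_def elem_smult_def smult_l_distr image_subset_iff)
  qed (auto simp: residual_in_ring_def)
qed (rule R.ring_axioms)

lemma residual_in_ring_proper_iff:
  assumes P: "submodule P R M" and L: "submodule L R M"
  shows "residual_in_ring R M P L \<noteq> carrier R \<longleftrightarrow> \<not> L \<subseteq> P"
proof -
  have "residual_in_ring R M P L = carrier R \<longleftrightarrow> \<one> \<in> residual_in_ring R M P L"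
    using ideal.one_imp_carrier[OF ideal_residual_in_ring[OF P L]] by auto
  also have "\<dots> \<longleftrightarrow> (\<forall>m\<in>L. \<one> \<odot>\<^bsub>M\<^esub> m \<in> P)"
    by (simp add: residual_in_ring_iff)
  also have "\<dots> \<longleftrightarrow> L \<subseteq> P"
    using submoduleE(1)[OF L] by (auto simp: subset_iff)
  finally show ?thesis by simp
qed

text \<open>Elements of \<open>IL\<close> are sums of products \<open>im\<close>, and \<open>P\<close> is closed under sums, so testing
  \<open>xIL \<subseteq> P\<close> on the products suffices.\<close>

lemma elem_smult_ideal_smult_subset_iff:
  assumes P: "submodule P R M" and L: "submodule L R M" and I: "I \<subseteq> carrier R"
    and x: "x \<in> carrier R"
  shows "elem_smult M x (ideal_smult M I L) \<subseteq> P \<longleftrightarrow> (\<forall>i\<in>I. x \<otimes> i \<in> residual_in_ring R M P L)"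
proof -
  have Lc: "m \<in> carrier M" if "m \<in> L" for m
    using submoduleE(1)[OF L] that by blast
  have carr: "s \<in> carrier M" if "s \<in> ideal_smult M I L" for s
    using that by induction (use I Lc in auto)
  have "x \<odot>\<^bsub>M\<^esub> s \<in> P"
    if gen: "\<forall>i\<in>I. x \<otimes> i \<in> residual_in_ring R M P L" and s: "s \<in> ideal_smult M I L" for s
    using s
  proof induction
    case (smult i m)
    then have "i \<in> carrier R"
      using I by blast
    moreover have "(x \<otimes> i) \<odot>\<^bsub>M\<^esub> m \<in> P"
      using gen smult by (auto simp: residual_in_ring_def elem_smult_def)
    ultimately show ?case
      using x Lc[OF smult(2)] by (simp add: smult_assoc1)
  next
    case (sum s t)
    then show ?case
      using x carr submoduleE(5)[OF P] by (simp add: smult_r_distr)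
  qed
  moreover have "x \<otimes> i \<in> residual_in_ring R M P L"
    if "elem_smult M x (ideal_smult M I L) \<subseteq> P" "i \<in> I" for i
  proof -
    have i: "i \<in> carrier R"
      using I that by blast
    have "x \<odot>\<^bsub>M\<^esub> (i \<odot>\<^bsub>M\<^esub> m) \<in> P" if m: "m \<in> L" for m
      using \<open>elem_smult M x (ideal_smult M I L) \<subseteq> P\<close> ideal_smult.smult[OF \<open>i \<in> I\<close> m, of M]
      by (auto simp: elem_smult_def)
    then show ?thesis
      using i x Lc by (simp add: residual_in_ring_iff smult_assoc1)
  qed
  ultimately show ?thesis
    by (auto simp: elem_smult_def)
qed

lemma ideal_smult_subset_iff:
  assumes P: "submodule P R M" and L: "submodule L R M" and I: "I \<subseteq> carrier R"
  shows "ideal_smult M I L \<subseteq> P \<longleftrightarrow> I \<subseteq> residual_in_ring R M P L"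
proof -
  have "s \<in> carrier M" if "s \<in> ideal_smult M I L" for s
    using that by induction (use I submoduleE(1)[OF L] in auto)
  then have "elem_smult M \<one> (ideal_smult M I L) = ideal_smult M I L"
    by (force simp: elem_smult_def)
  moreover have "(\<forall>i\<in>I. \<one> \<otimes> i \<in> residual_in_ring R M P L) \<longleftrightarrow> I \<subseteq> residual_in_ring R M P L"
    using I by (auto simp: subset_iff)
  ultimately show ?thesis
    using elem_smult_ideal_smult_subset_iff[OF P L I, of \<one>] by simp
qed

lemma elem_smult_elem_smult:
  assumes "L \<subseteq> carrier M" "x \<in> carrier R" "y \<in> carrier R"
  shows "elem_smult M x (elem_smult M y L) = elem_smult M (y \<otimes> x) L"
proof -
  have "x \<odot>\<^bsub>M\<^esub> (y \<odot>\<^bsub>M\<^esub> m) = (y \<otimes> x) \<odot>\<^bsub>M\<^esub> m" if "m \<in> L" for m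
    using assms that by (auto simp: m_comm[of y x] smult_assoc1)
  then show ?thesis
    unfolding elem_smult_def image_image by (intro image_cong) auto
qed

lemma residual_in_ring_elem_smult:
  assumes L: "submodule L R M" and y: "y \<in> carrier R"
  shows "residual_in_ring R M P (elem_smult M y L) = colon R (residual_in_ring R M P L) {y}"
proof -
  have "elem_smult M x (elem_smult M y L) \<subseteq> P \<longleftrightarrow> y \<otimes> x \<in> residual_in_ring R M P L"
    if "x \<in> carrier R" for x
    using that y by (simp add: elem_smult_elem_smult[OF submoduleE(1)[OF L]] elem_smult_subset_iff)
  then show ?thesis
    by (auto simp: residual_in_ring_def[of R M P "elem_smult M y L"] colon_def)
qed

lemma residual_in_ring_elem_smult_ideal_smult:
  assumes P: "submodule P R M" and L: "submodule L R M" and I: "ideal I R"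
    and y: "y \<in> carrier R"
  shows "residual_in_ring R M P (elem_smult M y (ideal_smult M I L)) =
    colon R (residual_in_ring R M P L) {y \<otimes> i | i. i \<in> I}"
proof -
  have Ic: "i \<in> carrier R" if "i \<in> I" for i
    using I that by (rule ideal.Icarr)
  have sub: "ideal_smult M I L \<subseteq> carrier M"
    using submoduleE(1)[OF ideal_smult_is_submodule[OF I L]] .
  have "elem_smult M x (elem_smult M y (ideal_smult M I L)) \<subseteq> P \<longleftrightarrow>
      (\<forall>i\<in>I. y \<otimes> i \<otimes> x \<in> residual_in_ring R M P L)" if x: "x \<in> carrier R" for x
  proof -
    have "y \<otimes> x \<otimes> i = y \<otimes> i \<otimes> x" if "i \<in> I" for i
      using x y Ic[OF that] by (simp add: m_ac)
    moreover have "I \<subseteq> carrier R"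
      using Ic by blast
    ultimately show ?thesis
      using x y by (simp add: elem_smult_elem_smult[OF sub] elem_smult_ideal_smult_subset_iff[OF P L])
  qed
  then show ?thesis
    by (auto simp: residual_in_ring_def[of R M P "elem_smult M y _"] colon_def)
qed

lemma residual_in_ring_ideal_prod_smult:
  assumes P: "submodule P R M" and L: "submodule L R M" and I: "ideal I R" and J: "ideal J R"
  shows "residual_in_ring R M P (ideal_smult M (I \<cdot> J) L) =
    colon R (residual_in_ring R M P L) {i \<otimes> j | i j. i \<in> I \<and> j \<in> J}"
proof -
  have Ic: "i \<in> carrier R" if "i \<in> I" for i
    using I that by (rule ideal.Icarr)
  have Jc: "j \<in> carrier R" if "j \<in> J" for j
    using J that by (rule ideal.Icarr)
  have "elem_smult M x (ideal_smult M (I \<cdot> J) L) \<subseteq> P \<longleftrightarrow>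
      (\<forall>i\<in>I. \<forall>j\<in>J. i \<otimes> j \<otimes> x \<in> residual_in_ring R M P L)" if x: "x \<in> carrier R" for x
  proof -
    have "x \<otimes> (i \<otimes> j) = i \<otimes> j \<otimes> x" if "i \<in> I" "j \<in> J" for i j
      using x Ic Jc that by (simp add: m_ac)
    then show ?thesis
      using x by (simp add: elem_smult_ideal_smult_subset_iff[OF P L ideal_prod_in_carrier[OF I J]]
          mult_ideal_prod_in_ideal_iff[OF ideal_residual_in_ring[OF P L] I J])
  qed
  then show ?thesis
    by (auto simp: residual_in_ring_def[of R M P "ideal_smult M _ L"] colon_def)
qed

section \<open>Classical 1-absorbing prime submodules\<close>

text \<open>If \<open>h \<in> L\<close> avoids \<open>K\<close> and \<open>k \<in> L\<close> avoids \<open>H\<close>, then \<open>h \<in> H\<close> and \<open>k \<in> K\<close>, so \<open>h + k\<close> lies in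
  neither \<open>H\<close> nor \<open>K\<close>, although it lies in \<open>L\<close>.\<close>

lemma submodule_subset_Un:
  assumes L: "submodule L R M" and H: "submodule H R M" and K: "submodule K R M"
    and LHK: "L \<subseteq> H \<union> K"
  shows "L \<subseteq> H \<or> L \<subseteq> K"
proof (rule ccontr)
  assume "\<not> (L \<subseteq> H \<or> L \<subseteq> K)"
  then obtain h k where hk: "h \<in> L" "h \<notin> K" "k \<in> L" "k \<notin> H"
    by blast
  then have in': "h \<in> H" "k \<in> K"
    using LHK by auto
  have c: "h \<in> carrier M" "k \<in> carrier M"
    using hk submoduleE(1)[OF L] by auto
  have "h \<oplus>\<^bsub>M\<^esub> k \<in> L"
    using hk submoduleE(5)[OF L] by blast
  then consider "h \<oplus>\<^bsub>M\<^esub> k \<in> H" | "h \<oplus>\<^bsub>M\<^esub> k \<in> K"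
    using LHK by blast
  then show False
  proof cases
    case 1
    then have "\<ominus>\<^bsub>M\<^esub> h \<oplus>\<^bsub>M\<^esub> (h \<oplus>\<^bsub>M\<^esub> k) \<in> H"
      using in' submoduleE(3,5)[OF H] by blast
    then show False
      using c hk by (simp add: M.r_neg1)
  next
    case 2
    then have "(h \<oplus>\<^bsub>M\<^esub> k) \<oplus>\<^bsub>M\<^esub> \<ominus>\<^bsub>M\<^esub> k \<in> K"
      using in' submoduleE(3,5)[OF K] by blast
    then show False
      using c hk by (simp add: M.a_assoc M.r_neg)
  qed
qed

lemma submodule_cyclic:
  assumes m: "m \<in> carrier M"
  shows "submodule {x \<odot>\<^bsub>M\<^esub> m | x. x \<in> carrier R} R M"
proof (rule submoduleI)
  show "\<zero>\<^bsub>M\<^esub> \<in> {x \<odot>\<^bsub>M\<^esub> m | x. x \<in> carrier R}"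
    using m by (auto intro!: exI[of _ \<zero>])
  show "\<ominus>\<^bsub>M\<^esub> a \<in> {x \<odot>\<^bsub>M\<^esub> m | x. x \<in> carrier R}" if "a \<in> {x \<odot>\<^bsub>M\<^esub> m | x. x \<in> carrier R}" for a
    using that m by (force simp flip: smult_l_minus)
  show "a \<oplus>\<^bsub>M\<^esub> b \<in> {x \<odot>\<^bsub>M\<^esub> m | x. x \<in> carrier R}"
    if "a \<in> {x \<odot>\<^bsub>M\<^esub> m | x. x \<in> carrier R}" "b \<in> {x \<odot>\<^bsub>M\<^esub> m | x. x \<in> carrier R}" for a b
    using that m by (force simp flip: smult_l_distr)
  show "a \<odot>\<^bsub>M\<^esub> b \<in> {x \<odot>\<^bsub>M\<^esub> m | x. x \<in> carrier R}"
    if "a \<in> carrier R" "b \<in> {x \<odot>\<^bsub>M\<^esub> m | x. x \<in> carrier R}" for a b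
    using that m by (force simp flip: smult_assoc1)
qed (use m in auto)

text \<open>Cyclic submodules \<open>L = Am\<close> recover conditions on the single element \<open>m\<close>.\<close>

lemma residual_in_ring_cyclic_iff:
  assumes P: "submodule P R M" and m: "m \<in> carrier M" and a: "a \<in> carrier R"
  shows "a \<in> residual_in_ring R M P {x \<odot>\<^bsub>M\<^esub> m | x. x \<in> carrier R} \<longleftrightarrow> a \<odot>\<^bsub>M\<^esub> m \<in> P"
proof
  assume "a \<in> residual_in_ring R M P {x \<odot>\<^bsub>M\<^esub> m | x. x \<in> carrier R}"
  then have "a \<odot>\<^bsub>M\<^esub> (\<one> \<odot>\<^bsub>M\<^esub> m) \<in> P"
    by (auto simp: residual_in_ring_iff[OF a])
  then show "a \<odot>\<^bsub>M\<^esub> m \<in> P"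
    using m by simp
next
  assume am: "a \<odot>\<^bsub>M\<^esub> m \<in> P"
  have "a \<odot>\<^bsub>M\<^esub> (x \<odot>\<^bsub>M\<^esub> m) \<in> P" if x: "x \<in> carrier R" for x
    using submoduleE(4)[OF P x am] a x m by (simp add: m_comm[of a x] flip: smult_assoc1)
  then show "a \<in> residual_in_ring R M P {x \<odot>\<^bsub>M\<^esub> m | x. x \<in> carrier R}"
    by (auto simp: residual_in_ring_iff[OF a])
qed

lemma residual_in_module_mono_mult:
  assumes P: "submodule P R M" and x: "x \<in> carrier R" and y: "y \<in> carrier R"
  shows "residual_in_module M P x \<subseteq> residual_in_module M P (y \<otimes> x)"
  using x y submoduleE(4)[OF P] by (auto simp: residual_in_module_def smult_assoc1)

text \<open>The elementwise condition only covers \<open>(P :\<^sub>M abc)\<close> by the union of \<open>(P :\<^sub>M ab)\<close> and \<open>(P :\<^sub>M c)\<close>,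
  where the alternative may depend on \<open>m\<close>. All three are submodules, so one alternative holds
  uniformly.\<close>

lemma classical_1_absorbing_prime_iff_residual_in_module:
  assumes P: "submodule P R M" "P \<noteq> carrier M"
  shows "classical_1_absorbing_prime_submodule P R M \<longleftrightarrow>
    (\<forall>a\<in>nonunits R. \<forall>b\<in>nonunits R. \<forall>c\<in>nonunits R.
       residual_in_module M P (a \<otimes> b \<otimes> c) = residual_in_module M P (a \<otimes> b) \<or>
       residual_in_module M P (a \<otimes> b \<otimes> c) = residual_in_module M P c)" (is "?C \<longleftrightarrow> ?R")
proof
  assume C: ?C
  show ?R
  proof (intro ballI)
    fix a b c
    assume abc: "a \<in> nonunits R" "b \<in> nonunits R" "c \<in> nonunits R"
    then have cl: "a \<otimes> b \<in> carrier R" "c \<in> carrier R"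
      by (auto simp: nonunits_closed)
    have "residual_in_module M P (a \<otimes> b \<otimes> c) \<subseteq> residual_in_module M P (a \<otimes> b) \<union> residual_in_module M P c"
      using C abc by (auto simp: residual_in_module_def classical_1_absorbing_prime_submodule_def)
    then have "residual_in_module M P (a \<otimes> b \<otimes> c) \<subseteq> residual_in_module M P (a \<otimes> b) \<or>
        residual_in_module M P (a \<otimes> b \<otimes> c) \<subseteq> residual_in_module M P c"
      using cl by (intro submodule_subset_Un submodule_residual_in_module P) auto
    moreover have "residual_in_module M P c \<subseteq> residual_in_module M P (a \<otimes> b \<otimes> c)"
      "residual_in_module M P (a \<otimes> b) \<subseteq> residual_in_module M P (a \<otimes> b \<otimes> c)"
      using residual_in_module_mono_mult[OF P(1), of c "a \<otimes> b"]
        residual_in_module_mono_mult[OF P(1), of "a \<otimes> b" c] cl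
      by (simp_all add: m_comm[of c "a \<otimes> b"])
    ultimately show "residual_in_module M P (a \<otimes> b \<otimes> c) = residual_in_module M P (a \<otimes> b) \<or>
       residual_in_module M P (a \<otimes> b \<otimes> c) = residual_in_module M P c"
      by blast
  qed
next
  assume ?R
  then show ?C
    using P unfolding classical_1_absorbing_prime_submodule_def residual_in_module_def by blast
qed

text \<open>The passage from modules to rings. The uniform alternative of the preceding lemma is what allows
  \<open>m\<close> to be replaced by a whole submodule \<open>L\<close>, because \<open>x \<in> (P :\<^sub>A L)\<close> means \<open>L \<subseteq> (P :\<^sub>M x)\<close>.\<close>

lemma classical_1_absorbing_prime_iff_absorbs_triples:
  assumes P: "submodule P R M" "P \<noteq> carrier M"
  shows "classical_1_absorbing_prime_submodule P R M \<longleftrightarrow>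
    (\<forall>L. submodule L R M \<longrightarrow> absorbs_triples R (residual_in_ring R M P L))" (is "?C \<longleftrightarrow> ?R")
proof
  assume C: ?C
  have mem: "x \<in> residual_in_ring R M P L \<longleftrightarrow> L \<subseteq> residual_in_module M P x"
    if "x \<in> carrier R" "submodule L R M" for x L
    using that submoduleE(1)[OF that(2)] by (auto simp: residual_in_ring_iff residual_in_module_def)
  show ?R
    unfolding absorbs_triples_def
  proof (intro allI ballI impI)
    fix L a b c
    assume L: "submodule L R M"
      and abc: "a \<in> nonunits R" "b \<in> nonunits R" "c \<in> nonunits R"
      and *: "a \<otimes> b \<otimes> c \<in> residual_in_ring R M P L"
    note cl = abc[THEN nonunits_closed]
    have "L \<subseteq> residual_in_module M P (a \<otimes> b \<otimes> c)"
      using * cl by (simp add: mem[OF _ L])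
    moreover have "residual_in_module M P (a \<otimes> b \<otimes> c) = residual_in_module M P (a \<otimes> b) \<or>
        residual_in_module M P (a \<otimes> b \<otimes> c) = residual_in_module M P c"
      using C abc unfolding classical_1_absorbing_prime_iff_residual_in_module[OF P] by blast
    ultimately show "a \<otimes> b \<in> residual_in_ring R M P L \<or> c \<in> residual_in_ring R M P L"
      using cl by (auto simp: mem[OF _ L])
  qed
next
  assume R: ?R
  show ?C
    unfolding classical_1_absorbing_prime_submodule_def
  proof (intro conjI ballI impI P)
    fix a b c m
    assume abc: "a \<in> nonunits R" "b \<in> nonunits R" "c \<in> nonunits R" and m: "m \<in> carrier M"
      and *: "(a \<otimes> b \<otimes> c) \<odot>\<^bsub>M\<^esub> m \<in> P"
    note cl = abc[THEN nonunits_closed]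
    let ?Q = "residual_in_ring R M P {x \<odot>\<^bsub>M\<^esub> m | x. x \<in> carrier R}"
    have "a \<otimes> b \<otimes> c \<in> ?Q"
      using * cl by (simp add: residual_in_ring_cyclic_iff[OF P(1) m])
    then have "a \<otimes> b \<in> ?Q \<or> c \<in> ?Q"
      using R submodule_cyclic[OF m] abc unfolding absorbs_triples_def by blast
    then show "(a \<otimes> b) \<odot>\<^bsub>M\<^esub> m \<in> P \<or> c \<odot>\<^bsub>M\<^esub> m \<in> P"
      using cl by (simp add: residual_in_ring_cyclic_iff[OF P(1) m])
  qed
qed

end

theorem theorem4:
  fixes A :: "('a, 'c) ring_scheme" and M :: "('a, 'b, 'd) module_scheme" and P :: "'b set"
  assumes "Module.module A M"
    and "\<one>\<^bsub>A\<^esub> \<noteq> \<zero>\<^bsub>A\<^esub>"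
    and "submodule P A M"
    and "P \<noteq> carrier M"
  shows "(classical_1_absorbing_prime_submodule P A M \<longleftrightarrow>
       (\<forall>a\<in>nonunits A. \<forall>b\<in>nonunits A. \<forall>c\<in>nonunits A.
          residual_in_module M P (a \<otimes>\<^bsub>A\<^esub> b \<otimes>\<^bsub>A\<^esub> c) = residual_in_module M P (a \<otimes>\<^bsub>A\<^esub> b) \<or>
          residual_in_module M P (a \<otimes>\<^bsub>A\<^esub> b \<otimes>\<^bsub>A\<^esub> c) = residual_in_module M P c))
    \<and> (classical_1_absorbing_prime_submodule P A M \<longleftrightarrow>
       (\<forall>a\<in>nonunits A. \<forall>b\<in>nonunits A. \<forall>c\<in>nonunits A. (\<forall>L. submodule L A M \<longrightarrow>
          elem_smult M (a \<otimes>\<^bsub>A\<^esub> b \<otimes>\<^bsub>A\<^esub> c) L \<subseteq> P \<longrightarrow>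
          elem_smult M (a \<otimes>\<^bsub>A\<^esub> b) L \<subseteq> P \<or> elem_smult M c L \<subseteq> P)))
    \<and> (classical_1_absorbing_prime_submodule P A M \<longleftrightarrow>
       (\<forall>a\<in>nonunits A. \<forall>b\<in>nonunits A. (\<forall>L. submodule L A M \<and> \<not> elem_smult M (a \<otimes>\<^bsub>A\<^esub> b) L \<subseteq> P \<longrightarrow>
          residual_in_ring A M P (elem_smult M (a \<otimes>\<^bsub>A\<^esub> b) L) = residual_in_ring A M P L)))
    \<and> (classical_1_absorbing_prime_submodule P A M \<longleftrightarrow>
       (\<forall>a\<in>nonunits A. \<forall>b\<in>nonunits A. (\<forall>I L. proper_ideal I A \<and> submodule L A M \<longrightarrow>
          elem_smult M (a \<otimes>\<^bsub>A\<^esub> b) (ideal_smult M I L) \<subseteq> P \<longrightarrow>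
          elem_smult M (a \<otimes>\<^bsub>A\<^esub> b) L \<subseteq> P \<or> ideal_smult M I L \<subseteq> P)))
    \<and> (classical_1_absorbing_prime_submodule P A M \<longleftrightarrow>
       (\<forall>a\<in>nonunits A. (\<forall>I L. proper_ideal I A \<and> submodule L A M \<and> \<not> elem_smult M a (ideal_smult M I L) \<subseteq> P \<longrightarrow>
          residual_in_ring A M P (elem_smult M a (ideal_smult M I L)) = residual_in_ring A M P L)))
    \<and> (classical_1_absorbing_prime_submodule P A M \<longleftrightarrow>
       (\<forall>a\<in>nonunits A. (\<forall>I J L. proper_ideal I A \<and> proper_ideal J A \<and> submodule L A M \<longrightarrow>
          elem_smult M a (ideal_smult M (I \<cdot>\<^bsub>A\<^esub> J) L) \<subseteq> P \<longrightarrow>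
          elem_smult M a (ideal_smult M I L) \<subseteq> P \<or> ideal_smult M J L \<subseteq> P)))
    \<and> (classical_1_absorbing_prime_submodule P A M \<longleftrightarrow>
       (\<forall>I J L. proper_ideal I A \<and> proper_ideal J A \<and> submodule L A M \<and> \<not> ideal_smult M (I \<cdot>\<^bsub>A\<^esub> J) L \<subseteq> P \<longrightarrow>
          residual_in_ring A M P (ideal_smult M (I \<cdot>\<^bsub>A\<^esub> J) L) = residual_in_ring A M P L))
    \<and> (classical_1_absorbing_prime_submodule P A M \<longleftrightarrow>
       (\<forall>I J K L. proper_ideal I A \<and> proper_ideal J A \<and> proper_ideal K A \<and> submodule L A M \<longrightarrow>
          ideal_smult M (I \<cdot>\<^bsub>A\<^esub> J \<cdot>\<^bsub>A\<^esub> K) L \<subseteq> P \<longrightarrow>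
          ideal_smult M (I \<cdot>\<^bsub>A\<^esub> J) L \<subseteq> P \<or> ideal_smult M K L \<subseteq> P))
    \<and> (classical_1_absorbing_prime_submodule P A M \<longleftrightarrow>
       (\<forall>L. submodule L A M \<and> \<not> L \<subseteq> P \<longrightarrow>
          one_absorbing_prime_ideal (residual_in_ring A M P L) A))"
proof -
  interpret Module.module A M by fact
  note P = assms(3,4)
  let ?Q = "\<lambda>L. residual_in_ring A M P L"
  have Q: "ideal (?Q L) A" if "submodule L A M" for L
    using ideal_residual_in_ring[OF P(1) that] .
  note C = classical_1_absorbing_prime_iff_absorbs_triples[OF P]
  note ideal = proper_ideal_is_ideal
  have carr: "I \<subseteq> carrier A" if "proper_ideal I A" for I
    using that by (auto intro: proper_ideal_closed)
  note cl = nonunits_closed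

  \<comment> \<open>Each inclusion that occurs becomes a condition on the ideal \<open>?Q L\<close>. The hypothesis that \<open>L\<close> is a
    submodule in the first fact keeps rewriting from treating \<open>IL\<close> as the submodule, which would
    produce residuals of \<open>IL\<close> instead of \<open>L\<close>.\<close>
  have elem: "elem_smult M x L \<subseteq> P \<longleftrightarrow> x \<in> ?Q L" if "submodule L A M" "x \<in> carrier A" for x L
    using that(2) by (rule elem_smult_subset_iff)
  have one: "ideal_smult M I L \<subseteq> P \<longleftrightarrow> I \<subseteq> ?Q L"
    if "submodule L A M" "proper_ideal I A" for I L
    using ideal_smult_subset_iff[OF P(1) that(1) carr[OF that(2)]] .
  have elem_one: "elem_smult M x (ideal_smult M I L) \<subseteq> P \<longleftrightarrow> (\<forall>i\<in>I. x \<otimes>\<^bsub>A\<^esub> i \<in> ?Q L)"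
    if "submodule L A M" "proper_ideal I A" "x \<in> carrier A" for x I L
    using elem_smult_ideal_smult_subset_iff[OF P(1) that(1) carr[OF that(2)] that(3)] .
  have elem_two: "elem_smult M x (ideal_smult M (I \<cdot>\<^bsub>A\<^esub> J) L) \<subseteq> P \<longleftrightarrow>
      (\<forall>i\<in>I. \<forall>j\<in>J. x \<otimes>\<^bsub>A\<^esub> (i \<otimes>\<^bsub>A\<^esub> j) \<in> ?Q L)"
    if "submodule L A M" "proper_ideal I A" "proper_ideal J A" "x \<in> carrier A" for x I J L
    using elem_smult_ideal_smult_subset_iff[OF P(1) that(1) ideal_prod_in_carrier that(4)]
      mult_ideal_prod_in_ideal_iff[OF Q ideal ideal] that by (simp add: ideal)
  have two: "ideal_smult M (I \<cdot>\<^bsub>A\<^esub> J) L \<subseteq> P \<longleftrightarrow> (\<forall>i\<in>I. \<forall>j\<in>J. i \<otimes>\<^bsub>A\<^esub> j \<in> ?Q L)"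
    if L: "submodule L A M" and I: "ideal I A" and J: "ideal J A" for I J L
    by (simp add: ideal_smult_subset_iff[OF P(1) L ideal_prod_in_carrier[OF I J]]
        ideal_prod_subset_ideal_iff[OF Q[OF L] I J])
  have three: "ideal_smult M (I \<cdot>\<^bsub>A\<^esub> J \<cdot>\<^bsub>A\<^esub> K) L \<subseteq> P \<longleftrightarrow>
      (\<forall>i\<in>I. \<forall>j\<in>J. \<forall>k\<in>K. i \<otimes>\<^bsub>A\<^esub> j \<otimes>\<^bsub>A\<^esub> k \<in> ?Q L)"
    if L: "submodule L A M" and "proper_ideal I A" "proper_ideal J A" "proper_ideal K A" for I J K L
  proof -
    note IJK = that(2-4)[THEN ideal]
    have IJc: "s \<in> carrier A" if "s \<in> I \<cdot>\<^bsub>A\<^esub> J" for s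
      using ideal_prod_in_carrier[OF IJK(1,2)] that by blast
    have "ideal_smult M (I \<cdot>\<^bsub>A\<^esub> J \<cdot>\<^bsub>A\<^esub> K) L \<subseteq> P \<longleftrightarrow>
        (\<forall>s\<in>I \<cdot>\<^bsub>A\<^esub> J. \<forall>k\<in>K. s \<otimes>\<^bsub>A\<^esub> k \<in> ?Q L)"
      by (rule two[OF L ideal_prod_is_ideal[OF IJK(1,2)] IJK(3)])
    \<comment> \<open>With \<open>k\<close> in front, the inner product \<open>IJ\<close> can be resolved in the same way.\<close>
    also have "\<dots> \<longleftrightarrow> (\<forall>k\<in>K. \<forall>s\<in>I \<cdot>\<^bsub>A\<^esub> J. k \<otimes>\<^bsub>A\<^esub> s \<in> ?Q L)"
    proof -
      have "s \<otimes>\<^bsub>A\<^esub> k \<in> ?Q L \<longleftrightarrow> k \<otimes>\<^bsub>A\<^esub> s \<in> ?Q L" if "s \<in> I \<cdot>\<^bsub>A\<^esub> J" "k \<in> K" for s k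
        by (simp only: m_comm[OF IJc[OF that(1)] ideal.Icarr[OF IJK(3) that(2)]])
      then show ?thesis
        by blast
    qed
    also have "\<dots> \<longleftrightarrow> (\<forall>k\<in>K. \<forall>i\<in>I. \<forall>j\<in>J. k \<otimes>\<^bsub>A\<^esub> (i \<otimes>\<^bsub>A\<^esub> j) \<in> ?Q L)"
      using ideal.Icarr[OF IJK(3)] by (simp add: mult_ideal_prod_in_ideal_iff[OF Q[OF L] IJK(1,2)])
    also have "\<dots> \<longleftrightarrow> (\<forall>i\<in>I. \<forall>j\<in>J. \<forall>k\<in>K. i \<otimes>\<^bsub>A\<^esub> j \<otimes>\<^bsub>A\<^esub> k \<in> ?Q L)"
    proof -
      have "k \<otimes>\<^bsub>A\<^esub> (i \<otimes>\<^bsub>A\<^esub> j) = i \<otimes>\<^bsub>A\<^esub> j \<otimes>\<^bsub>A\<^esub> k" if "i \<in> I" "j \<in> J" "k \<in> K" for i j k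
        using that IJK by (intro m_comm m_closed ideal.Icarr)
      then show ?thesis
        by auto
    qed
    finally show ?thesis .
  qed
  note res_elem = residual_in_ring_elem_smult[where P = P]
  note res_elem_one = residual_in_ring_elem_smult_ideal_smult[OF P(1)]
  note res_two = residual_in_ring_ideal_prod_smult[OF P(1)]

  show ?thesis
  proof (intro conjI)
    show "classical_1_absorbing_prime_submodule P A M \<longleftrightarrow>
       (\<forall>a\<in>nonunits A. \<forall>b\<in>nonunits A. \<forall>c\<in>nonunits A.
          residual_in_module M P (a \<otimes>\<^bsub>A\<^esub> b \<otimes>\<^bsub>A\<^esub> c) = residual_in_module M P (a \<otimes>\<^bsub>A\<^esub> b) \<or>
          residual_in_module M P (a \<otimes>\<^bsub>A\<^esub> b \<otimes>\<^bsub>A\<^esub> c) = residual_in_module M P c)"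
      by (rule classical_1_absorbing_prime_iff_residual_in_module[OF P])
    show "classical_1_absorbing_prime_submodule P A M \<longleftrightarrow>
       (\<forall>a\<in>nonunits A. \<forall>b\<in>nonunits A. \<forall>c\<in>nonunits A. (\<forall>L. submodule L A M \<longrightarrow>
          elem_smult M (a \<otimes>\<^bsub>A\<^esub> b \<otimes>\<^bsub>A\<^esub> c) L \<subseteq> P \<longrightarrow>
          elem_smult M (a \<otimes>\<^bsub>A\<^esub> b) L \<subseteq> P \<or> elem_smult M c L \<subseteq> P))"
      unfolding C absorbs_triples_def by (simp add: elem cl cong: imp_cong) blast
    show "classical_1_absorbing_prime_submodule P A M \<longleftrightarrow>
       (\<forall>a\<in>nonunits A. \<forall>b\<in>nonunits A. (\<forall>L. submodule L A M \<and> \<not> elem_smult M (a \<otimes>\<^bsub>A\<^esub> b) L \<subseteq> P \<longrightarrow>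
          residual_in_ring A M P (elem_smult M (a \<otimes>\<^bsub>A\<^esub> b) L) = residual_in_ring A M P L))"
      unfolding C by (simp add: absorbs_triples_iff_colon_elem Q elem res_elem cl cong: imp_cong conj_cong) blast
    show "classical_1_absorbing_prime_submodule P A M \<longleftrightarrow>
       (\<forall>a\<in>nonunits A. \<forall>b\<in>nonunits A. (\<forall>I L. proper_ideal I A \<and> submodule L A M \<longrightarrow>
          elem_smult M (a \<otimes>\<^bsub>A\<^esub> b) (ideal_smult M I L) \<subseteq> P \<longrightarrow>
          elem_smult M (a \<otimes>\<^bsub>A\<^esub> b) L \<subseteq> P \<or> ideal_smult M I L \<subseteq> P))"
      unfolding C by (simp add: absorbs_triples_iff_mult_ideal Q elem elem_one one cl cong: imp_cong conj_cong) blast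
    show "classical_1_absorbing_prime_submodule P A M \<longleftrightarrow>
       (\<forall>a\<in>nonunits A. (\<forall>I L. proper_ideal I A \<and> submodule L A M \<and> \<not> elem_smult M a (ideal_smult M I L) \<subseteq> P \<longrightarrow>
          residual_in_ring A M P (elem_smult M a (ideal_smult M I L)) = residual_in_ring A M P L))"
      unfolding C by (simp add: absorbs_triples_iff_colon_mult_ideal Q elem_one res_elem_one ideal cl cong: imp_cong conj_cong) blast
    show "classical_1_absorbing_prime_submodule P A M \<longleftrightarrow>
       (\<forall>a\<in>nonunits A. (\<forall>I J L. proper_ideal I A \<and> proper_ideal J A \<and> submodule L A M \<longrightarrow>
          elem_smult M a (ideal_smult M (I \<cdot>\<^bsub>A\<^esub> J) L) \<subseteq> P \<longrightarrow>
          elem_smult M a (ideal_smult M I L) \<subseteq> P \<or> ideal_smult M J L \<subseteq> P))"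
      unfolding C by (simp add: absorbs_triples_iff_mult_two_ideals Q elem_two elem_one one cl cong: imp_cong conj_cong) blast
    show "classical_1_absorbing_prime_submodule P A M \<longleftrightarrow>
       (\<forall>I J L. proper_ideal I A \<and> proper_ideal J A \<and> submodule L A M \<and> \<not> ideal_smult M (I \<cdot>\<^bsub>A\<^esub> J) L \<subseteq> P \<longrightarrow>
          residual_in_ring A M P (ideal_smult M (I \<cdot>\<^bsub>A\<^esub> J) L) = residual_in_ring A M P L)"
      unfolding C by (simp add: absorbs_triples_iff_colon_two_ideals Q two res_two ideal cong: imp_cong conj_cong) blast
    show "classical_1_absorbing_prime_submodule P A M \<longleftrightarrow>
       (\<forall>I J K L. proper_ideal I A \<and> proper_ideal J A \<and> proper_ideal K A \<and> submodule L A M \<longrightarrow>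
          ideal_smult M (I \<cdot>\<^bsub>A\<^esub> J \<cdot>\<^bsub>A\<^esub> K) L \<subseteq> P \<longrightarrow>
          ideal_smult M (I \<cdot>\<^bsub>A\<^esub> J) L \<subseteq> P \<or> ideal_smult M K L \<subseteq> P)"
      unfolding C by (simp add: absorbs_triples_iff_mult_three_ideals Q three two one ideal cong: imp_cong conj_cong) blast
    show "classical_1_absorbing_prime_submodule P A M \<longleftrightarrow>
       (\<forall>L. submodule L A M \<and> \<not> L \<subseteq> P \<longrightarrow>
          one_absorbing_prime_ideal (residual_in_ring A M P L) A)"
    proof -
      have "absorbs_triples A (?Q L) \<longleftrightarrow> (\<not> L \<subseteq> P \<longrightarrow> one_absorbing_prime_ideal (?Q L) A)"
        if L: "submodule L A M" for L
      proof (cases "L \<subseteq> P")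
        case True
        \<comment> \<open>Here \<open>?Q L\<close> is the whole ring, which absorbs everything but is not proper.\<close>
        then have "?Q L = carrier A"
          using residual_in_ring_proper_iff[OF P(1) L] by blast
        then show ?thesis
          using True by (simp add: absorbs_triples_def cl)
      next
        case False
        then show ?thesis
          using residual_in_ring_proper_iff[OF P(1) L] Q[OF L]
          by (simp add: one_absorbing_prime_ideal_def absorbs_triples_def proper_ideal_def)
      qed
      then show ?thesis
        unfolding C by blast
    qed
  qed
qed

end
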